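(* For all integers $d$ and $m$ with $0 < d < 10$ and $m \geq 0$, the number $f(d,m,420)$ is composite.
   Context: For an integer $k \ge 0$ let $R(k) = \frac{10^k-1}{9}$ (the repunit, written in decimal with $k$ ones; $R(0)=0$). For a digit $d$, an integer $m \ge 0$ and a positive integer $n$ with exactly $t$ decimal digits, define $f(d,m,n) = dR(m)10^{t+m} + n10^m + dR(m)$; that is, $f(d,m,n)$ is the number whose decimal representation is obtained by writing the digit $d$ exactly $m$ times in front of $n$ and $m$ times after $n$ (e.g. $f(2,3,45) = 22245222$, and $f(d,0,n)=n$). *)

theory Defs
  imports "HOL-Computational_Algebra.Primes" "HOL-Library.Log_Nat"
begin

definition repunit :: "nat \<Rightarrow> nat" where
  "repunit k = (10 ^ k - 1) div 9"

(* The division in the definition of repunit is exact. *)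
lemma nine_mult_repunit: "9 * repunit k = 10 ^ k - 1"
proof -
  have "(9::nat) dvd 10 ^ k - 1"
  proof (induction k)
    case (Suc k)
    have "(10::nat) ^ Suc k - 1 = 9 * 10 ^ k + (10 ^ k - 1)"
      by simp
    with Suc show ?case
      by (metis dvd_add dvd_triv_left)
  qed simp
  then show ?thesis
    by (simp add: repunit_def)
qed

(* For n > 0, floorlog 10 n is the number of decimal digits of n, i.e. the t with
   10 ^ (t - 1) \<le> n < 10 ^ t. The definition is meant for d < 10 and n > 0. *)
definition f :: "nat \<Rightarrow> nat \<Rightarrow> nat \<Rightarrow> nat" where
  "f d m n = d * repunit m * 10 ^ (floorlog 10 n + m) + n * 10 ^ m + d * repunit m"

lemma f_example: "f 2 3 45 = 22245222"
  by (simp add: f_def repunit_def compute_floorlog)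

lemma f_0: "f d 0 n = n"
  by (simp add: f_def repunit_def)

definition composite :: "nat \<Rightarrow> bool" where
  "composite n \<longleftrightarrow> 1 < n \<and> \<not> prime n"

end

theory Submission
  imports Defs "HOL-Number_Theory.Cong"
begin

text \<open>
  Each number \<open>f d m 420\<close> is at least \<open>420\<close>, so any divisor strictly between \<open>1\<close> and \<open>420\<close>
  witnesses compositeness. Since \<open>420 = 4 \<cdot> 3 \<cdot> 5 \<cdot> 7\<close> contains all one-digit primes, every
  digit \<open>d > 1\<close> shares a factor with \<open>420\<close>, and a common divisor of \<open>d\<close> and \<open>n\<close> divides
  \<open>f d m n\<close> for every \<open>m\<close> (\<open>common_divisor_dvd_f\<close>).

  For \<open>d = 1\<close> the primes \<open>3\<close>, \<open>11\<close> and \<open>13\<close> form a covering system. All three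
  divide \<open>repunit 6 = 111111\<close>, and modulo \<open>repunit k\<close> the sequence
  \<open>m \<mapsto> f d m n\<close> is periodic with period \<open>k\<close> (\<open>f_cong_mod_index\<close>). So it suffices that every
  one of the six numbers \<open>f 1 r 420\<close> with \<open>r < 6\<close> is divisible by one of the three primes:
  \<open>3\<close> serves \<open>r = 0, 3\<close>, while \<open>11\<close> serves odd \<open>r\<close> and \<open>13\<close> serves \<open>r = 2, 4\<close>.
\<close>

lemma composite_if_proper_divisor:
  assumes "p dvd N" "1 < p" "p < N"
  shows "composite N"
  using assms by (auto simp: composite_def prime_nat_iff)

lemma le_f: "n \<le> f d m n"
proof -
  have "n * 1 \<le> n * 10 ^ m"
    by (intro mult_le_mono) simp_all
  then show ?thesis
    unfolding f_def by linarith
qed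

lemma common_divisor_dvd_f:
  assumes "p dvd d" "p dvd n"
  shows "p dvd f d m n"
  using assms by (simp add: f_def)

lemma power_10_eq_repunit: "10 ^ k = Suc (9 * repunit k)"
  by (simp add: nine_mult_repunit)

lemma repunit_add: "repunit (m + k) = repunit m + 10 ^ m * repunit k"
proof -
  have "Suc (9 * repunit (m + k)) = 10 ^ m * Suc (9 * repunit k)"
    by (simp add: power_add flip: power_10_eq_repunit)
  also have "\<dots> = Suc (9 * (repunit m + 10 ^ m * repunit k))"
    by (simp add: power_10_eq_repunit algebra_simps)
  finally show ?thesis
    by simp
qed

text \<open>
  The value \<open>f d m n\<close> depends on \<open>m\<close> only through \<open>10 ^ m\<close> and \<open>repunit m\<close>. The former
  repeats modulo \<open>10 ^ k - 1\<close>, but the latter, having been divided by \<open>9\<close>, only modulo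
  \<open>(10 ^ k - 1) / 9\<close>; this is why the modulus is \<open>repunit k\<close>. It matters for the prime \<open>3\<close>,
  which divides \<open>10 ^ k - 1\<close> always but \<open>repunit k\<close> only if \<open>3\<close> divides \<open>k\<close>.
\<close>
lemma f_add_cong: "[f d (m + k) n = f d m n] (mod repunit k)"
proof -
  have power: "[10 ^ (m + k) = 10 ^ m] (mod repunit k)"
  proof -
    have "10 ^ (m + k) = 10 ^ m + repunit k * (9 * 10 ^ m)"
      by (simp add: power_add power_10_eq_repunit[of k])
    then show ?thesis
      by (simp add: cong_def)
  qed
  have repunit: "[repunit (m + k) = repunit m] (mod repunit k)"
    by (simp add: repunit_add cong_def)
  show ?thesis
    unfolding f_def power_add[of _ "floorlog 10 n"]
    by (rule power repunit cong_refl cong_add cong_mult)+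
qed

lemma f_cong_mod_index: "[f d m n = f d (m mod k) n] (mod repunit k)"
proof -
  have "[f d (r + q * k) n = f d r n] (mod repunit k)" for r q
  proof (induction q)
    case (Suc q)
    have "[f d (r + q * k + k) n = f d (r + q * k) n] (mod repunit k)"
      by (rule f_add_cong)
    from cong_trans[OF this Suc] show ?case
      by (simp add: ac_simps)
  qed simp
  from this[of "m mod k" "m div k"] show ?thesis
    by simp
qed

lemma small_factor_f_1: "\<exists>p \<in> {3, 11, 13}. p dvd f 1 m 420"
proof -
  have repunit_6: "repunit 6 = 111111"
    by (simp add: repunit_def)
  have reduce: "p dvd f 1 m 420 \<longleftrightarrow> p dvd f 1 (m mod 6) 420" if "p dvd repunit 6" for p
    using that by (intro cong_dvd_iff cong_dvd_modulus_nat[OF f_cong_mod_index])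
  have "m mod 6 \<in> {0, 1, 2, 3, 4, 5}"
    by auto
  then have "\<exists>p \<in> {3, 11, 13}. p dvd f 1 (m mod 6) 420"
    by (auto simp: f_def repunit_def compute_floorlog)
  moreover have "p dvd repunit 6" if "p \<in> {3, 11, 13}" for p
    using that by (auto simp: repunit_6)
  ultimately show ?thesis
    using reduce by blast
qed

theorem theorem2:
  fixes d m :: nat
  assumes "0 < d" and "d < 10"
  shows "composite (f d m 420)"
proof -
  have "\<exists>p. p dvd f d m 420 \<and> 1 < p \<and> p < 420"
  proof (cases "d = 1")
    case True
    then show ?thesis
      using small_factor_f_1[of m] by auto
  next
    case False
    with assms have "d \<in> {2, 3, 4, 5, 6, 7, 8, 9}"
      by auto
    then have "\<exists>p \<in> {2, 3, 5, 7}. p dvd d"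
      by auto
    then obtain p where p: "p \<in> {2, 3, 5, 7}" "p dvd d" ..
    then have "p dvd 420"
      by auto
    with p(2) have "p dvd f d m 420"
      by (rule common_divisor_dvd_f)
    with p(1) show ?thesis
      by auto
  qed
  then obtain p where p: "p dvd f d m 420" "1 < p" "p < 420"
    by blast
  from p(3) le_f have "p < f d m 420"
    by (rule less_le_trans)
  with p(1,2) show ?thesis
    by (rule composite_if_proper_divisor)
qed

end
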